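(* Let $z^\ast$ be a local optimal solution of the MPVC, where all functions are continuously differentiable at $z^\ast$. If either MPVC-GMFCQ or the MPVC-linear constraint qualification is satisfied at $z^\ast$, then $z^\ast$ is an M-stationary point of the MPVC.
   Context: The mathematical program with vanishing constraints (MPVC) is: minimize $f(x)$ over $x\in\mathbb{R}^n$ subject to $g_i(x)\le 0$ ($i=1,\dots,m$), $h_i(x)=0$ ($i=1,\dots,p$), $H_i(x)\ge 0$ and $G_i(x)H_i(x)\le 0$ ($i=1,\dots,q$), where all functions $f,g_i,h_i,G_i,H_i:\mathbb{R}^n\to\mathbb{R}$ are continuously differentiable. Let $\mathcal{C}$ be its feasible set. For $x^\ast\in\mathcal{C}$ put $I_g=\{i: g_i(x^\ast)=0\}$, $I_+=\{i:H_i(x^\ast)>0\}$, $I_{+0}=\{i:H_i(x^\ast)>0,G_i(x^\ast)=0\}$, $I_{+-}=\{i:H_i(x^\ast)>0,G_i(x^\ast)<0\}$, $I_{00}=\{i:H_i(x^\ast)=0,G_i(x^\ast)=0\}$, $I_{0+}=\{i:H_i(x^\ast)=0,G_i(x^\ast)>0\}$, $I_{0-}=\{i:H_i(x^\ast)=0,G_i(x^\ast)<0\}$. A vector $(\lambda,\mu,\eta^G,\eta^H)\in\mathbb{R}^m\times\mathbb{R}^p\times\mathbb{R}^q\times\mathbb{R}^q$ satisfies the M-sign conditions at $x^\ast$ if: $\lambda_i\ge0$ for $i\in I_g$, $\lambda_i=0$ for $i\notin I_g$; $\eta_i^G=0$ for $i\in I_{+-}\cup I_{0-}\cup I_{0+}$,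 $\eta_i^G\ge0$ for $i\in I_{+0}\cup I_{00}$; $\eta_i^H=0$ for $i\in I_+$, $\eta_i^H\ge0$ for $i\in I_{0-}$, $\eta_i^H$ free for $i\in I_{0+}$; $\eta_i^H\eta_i^G=0$ for $i\in I_{00}$. MPVC-GMFCQ holds at $x^\ast\in\mathcal{C}$ if there is no nonzero $(\lambda,\mu,\eta^G,\eta^H)$ satisfying the M-sign conditions at $x^\ast$ and $\sum_{i=1}^m\lambda_i\nabla g_i(x^\ast)+\sum_{i=1}^p\mu_i\nabla h_i(x^\ast)+\sum_{i=1}^q\eta_i^G\nabla G_i(x^\ast)-\sum_{i=1}^q\eta_i^H\nabla H_i(x^\ast)=0$. The MPVC-linear constraint qualification is satisfied if all the functions $g_i,h_i,G_i,H_i$ are affine. A feasible point $x^\ast$ is M-stationary if there is $(\lambda,\mu,\eta^G,\eta^H)$ satisfying the M-sign conditions at $x^\ast$ and $\nabla f(x^\ast)+\sum_{i=1}^m\lambda_i\nabla g_i(x^\ast)+\sum_{i=1}^p\mu_i\nabla h_i(x^\ast)+\sum_{i=1}^q\eta_i^G\nabla G_i(x^\ast)-\sum_{i=1}^q\eta_i^H\nabla H_i(x^\ast)=0$. *)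

theory Defs
  imports "HOL-Analysis.Analysis"
begin

text \<open>The number of constraints of each kind may be zero, so constraint families and multipliers
  are functions on \<^typ>\<open>nat\<close> of which only the indices \<open>1, \<dots>, m\<close> (respectively \<open>p\<close>, \<open>q\<close>) matter;
  everything below looks only at those indices.\<close>

record ('n::finite) mpvc =
  num_g :: nat
  num_h :: nat
  num_GH :: nat
  obj :: "real ^ 'n \<Rightarrow> real"
  con_g :: "nat \<Rightarrow> real ^ 'n \<Rightarrow> real"
  con_h :: "nat \<Rightarrow> real ^ 'n \<Rightarrow> real"
  con_G :: "nat \<Rightarrow> real ^ 'n \<Rightarrow> real"
  con_H :: "nat \<Rightarrow> real ^ 'n \<Rightarrow> real"

definition feasible_set :: "('n::finite) mpvc \<Rightarrow> (real ^ 'n) set" where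
  "feasible_set P = {x.
     (\<forall>i\<in>{1..num_g P}. con_g P i x \<le> 0) \<and>
     (\<forall>i\<in>{1..num_h P}. con_h P i x = 0) \<and>
     (\<forall>i\<in>{1..num_GH P}. con_H P i x \<ge> 0 \<and> con_G P i x * con_H P i x \<le> 0)}"

definition local_optimal_solution :: "('n::finite) mpvc \<Rightarrow> real ^ 'n \<Rightarrow> bool" where
  "local_optimal_solution P z \<longleftrightarrow> z \<in> feasible_set P \<and>
     (\<exists>\<epsilon>>0. \<forall>x\<in>feasible_set P. dist x z < \<epsilon> \<longrightarrow> obj P z \<le> obj P x)"

text \<open>Unspecified where \<open>\<phi>\<close> is not differentiable.\<close>

definition gradient :: "(real ^ 'n \<Rightarrow> real) \<Rightarrow> real ^ 'n \<Rightarrow> real ^ ('n::finite)" where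
  "gradient \<phi> x = (THE d. GDERIV \<phi> x :> d)"

lemma gradient_eqI:
  assumes "GDERIV \<phi> x :> d"
  shows "gradient \<phi> x = d"
  unfolding gradient_def
proof (rule the_equality)
  show "GDERIV \<phi> x :> d" by (rule assms)
next
  fix d' assume "GDERIV \<phi> x :> d'"
  then have "(\<lambda>h. h \<bullet> d') = (\<lambda>h. h \<bullet> d)"
    using assms has_derivative_unique unfolding gderiv_def by blast
  then show "d' = d"
    by (metis inner_commute vector_eq_rdot)
qed

text \<open>Pointwise notion: differentiability near \<open>z\<close>, with a gradient continuous at \<open>z\<close> (it need not be
  continuous elsewhere).\<close>

definition cont_differentiable_at :: "(real ^ 'n \<Rightarrow> real) \<Rightarrow> real ^ ('n::finite) \<Rightarrow> bool" where
  "cont_differentiable_at \<phi> z \<longleftrightarrow>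
     (\<forall>\<^sub>F x in nhds z. \<phi> differentiable (at x)) \<and> isCont (gradient \<phi>) z"

definition mpvc_cont_differentiable_at :: "('n::finite) mpvc \<Rightarrow> real ^ 'n \<Rightarrow> bool" where
  "mpvc_cont_differentiable_at P z \<longleftrightarrow>
     cont_differentiable_at (obj P) z \<and>
     (\<forall>i\<in>{1..num_g P}. cont_differentiable_at (con_g P i) z) \<and>
     (\<forall>i\<in>{1..num_h P}. cont_differentiable_at (con_h P i) z) \<and>
     (\<forall>i\<in>{1..num_GH P}. cont_differentiable_at (con_G P i) z \<and> cont_differentiable_at (con_H P i) z)"

definition I_g :: "('n::finite) mpvc \<Rightarrow> real ^ 'n \<Rightarrow> nat set" where
  "I_g P x = {i\<in>{1..num_g P}. con_g P i x = 0}"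

definition I_plus :: "('n::finite) mpvc \<Rightarrow> real ^ 'n \<Rightarrow> nat set" where
  "I_plus P x = {i\<in>{1..num_GH P}. con_H P i x > 0}"

definition I_plus_zero :: "('n::finite) mpvc \<Rightarrow> real ^ 'n \<Rightarrow> nat set" where
  "I_plus_zero P x = {i\<in>{1..num_GH P}. con_H P i x > 0 \<and> con_G P i x = 0}"

definition I_plus_minus :: "('n::finite) mpvc \<Rightarrow> real ^ 'n \<Rightarrow> nat set" where
  "I_plus_minus P x = {i\<in>{1..num_GH P}. con_H P i x > 0 \<and> con_G P i x < 0}"

definition I_zero_zero :: "('n::finite) mpvc \<Rightarrow> real ^ 'n \<Rightarrow> nat set" where
  "I_zero_zero P x = {i\<in>{1..num_GH P}. con_H P i x = 0 \<and> con_G P i x = 0}"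

definition I_zero_plus :: "('n::finite) mpvc \<Rightarrow> real ^ 'n \<Rightarrow> nat set" where
  "I_zero_plus P x = {i\<in>{1..num_GH P}. con_H P i x = 0 \<and> con_G P i x > 0}"

definition I_zero_minus :: "('n::finite) mpvc \<Rightarrow> real ^ 'n \<Rightarrow> nat set" where
  "I_zero_minus P x = {i\<in>{1..num_GH P}. con_H P i x = 0 \<and> con_G P i x < 0}"

text \<open>No sign is imposed on \<open>etaH\<close> over \<^const>\<open>I_zero_plus\<close>, and over \<^const>\<open>I_zero_zero\<close> it is
  restricted only by complementarity with \<open>etaG\<close>.\<close>

definition M_sign_conditions ::
    "('n::finite) mpvc \<Rightarrow> real ^ 'n \<Rightarrow>
     (nat \<Rightarrow> real) \<Rightarrow> (nat \<Rightarrow> real) \<Rightarrow> (nat \<Rightarrow> real) \<Rightarrow> (nat \<Rightarrow> real) \<Rightarrow> bool" where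
  "M_sign_conditions P x lam mu etaG etaH \<longleftrightarrow>
     (\<forall>i\<in>I_g P x. lam i \<ge> 0) \<and>
     (\<forall>i\<in>{1..num_g P} - I_g P x. lam i = 0) \<and>
     (\<forall>i\<in>I_plus_minus P x \<union> I_zero_minus P x \<union> I_zero_plus P x. etaG i = 0) \<and>
     (\<forall>i\<in>I_plus_zero P x \<union> I_zero_zero P x. etaG i \<ge> 0) \<and>
     (\<forall>i\<in>I_plus P x. etaH i = 0) \<and>
     (\<forall>i\<in>I_zero_minus P x. etaH i \<ge> 0) \<and>
     (\<forall>i\<in>I_zero_zero P x. etaH i * etaG i = 0)"

definition constraint_gradient_sum ::
    "('n::finite) mpvc \<Rightarrow> real ^ 'n \<Rightarrow>
     (nat \<Rightarrow> real) \<Rightarrow> (nat \<Rightarrow> real) \<Rightarrow> (nat \<Rightarrow> real) \<Rightarrow> (nat \<Rightarrow> real) \<Rightarrow> real ^ 'n" where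
  "constraint_gradient_sum P x lam mu etaG etaH =
     (\<Sum>i=1..num_g P. lam i *\<^sub>R gradient (con_g P i) x) +
     (\<Sum>i=1..num_h P. mu i *\<^sub>R gradient (con_h P i) x) +
     (\<Sum>i=1..num_GH P. etaG i *\<^sub>R gradient (con_G P i) x) -
     (\<Sum>i=1..num_GH P. etaH i *\<^sub>R gradient (con_H P i) x)"

definition nonzero_multiplier ::
    "('n::finite) mpvc \<Rightarrow>
     (nat \<Rightarrow> real) \<Rightarrow> (nat \<Rightarrow> real) \<Rightarrow> (nat \<Rightarrow> real) \<Rightarrow> (nat \<Rightarrow> real) \<Rightarrow> bool" where
  "nonzero_multiplier P lam mu etaG etaH \<longleftrightarrow>
     (\<exists>i\<in>{1..num_g P}. lam i \<noteq> 0) \<or> (\<exists>i\<in>{1..num_h P}. mu i \<noteq> 0) \<or>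
     (\<exists>i\<in>{1..num_GH P}. etaG i \<noteq> 0) \<or> (\<exists>i\<in>{1..num_GH P}. etaH i \<noteq> 0)"

definition MPVC_GMFCQ :: "('n::finite) mpvc \<Rightarrow> real ^ 'n \<Rightarrow> bool" where
  "MPVC_GMFCQ P x \<longleftrightarrow> x \<in> feasible_set P \<and>
     \<not> (\<exists>lam mu etaG etaH. nonzero_multiplier P lam mu etaG etaH \<and>
          M_sign_conditions P x lam mu etaG etaH \<and>
          constraint_gradient_sum P x lam mu etaG etaH = 0)"

definition affine_function :: "(real ^ 'n \<Rightarrow> real) \<Rightarrow> bool" where
  "affine_function \<phi> \<longleftrightarrow> (\<exists>a b. \<forall>x. \<phi> x = a \<bullet> x + b)"

definition MPVC_linear_CQ :: "('n::finite) mpvc \<Rightarrow> bool" where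
  "MPVC_linear_CQ P \<longleftrightarrow>
     (\<forall>i\<in>{1..num_g P}. affine_function (con_g P i)) \<and>
     (\<forall>i\<in>{1..num_h P}. affine_function (con_h P i)) \<and>
     (\<forall>i\<in>{1..num_GH P}. affine_function (con_G P i) \<and> affine_function (con_H P i))"

definition M_stationary :: "('n::finite) mpvc \<Rightarrow> real ^ 'n \<Rightarrow> bool" where
  "M_stationary P x \<longleftrightarrow> x \<in> feasible_set P \<and>
     (\<exists>lam mu etaG etaH. M_sign_conditions P x lam mu etaG etaH \<and>
        gradient (obj P) x + constraint_gradient_sum P x lam mu etaG etaH = 0)"

end

theory Submission
  imports Defs
begin

text \<open>Near \<open>z\<close> the feasible set contains the branch in which \<open>H\<^sub>i = 0\<close> for every biactive index \<open>i\<close>.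
  On this branch the problem is an ordinary nonlinear program without \<open>G\<^sub>i\<close> for such \<open>i\<close>, so its KKT
  multipliers have \<open>\<eta>\<^sup>G\<^sub>i = 0\<close> and \<open>\<eta>\<^sup>H\<^sub>i\<close> free there, which is one of the alternatives allowed by
  M-stationarity. The point \<open>z\<close> remains a local minimizer on the branch, and KKT multipliers for
  the branch come from a quadratic penalty: minimizing \<open>f x + (dist x z)\<^sup>2\<close> plus a large multiple of
  the squared constraint violation gives points near \<open>z\<close> with exact multipliers. Under GMFCQ the
  normalized multipliers have a limit whose objective part is nonzero; for affine constraints the
  constraint gradients span a constant finitely generated cone, which is closed.\<close>

section \<open>Quadratic penalties and multipliers at nearby points\<close>

lemma has_real_derivative_max_0_squared:
  "((\<lambda>t::real. (max 0 t)\<^sup>2) has_real_derivative 2 * max 0 t) (at t)"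
proof (cases t "0::real" rule: linorder_cases)
  case less
  have "((\<lambda>t::real. 0) has_real_derivative 2 * max 0 t) (at t)"
    using less by simp
  then show ?thesis
    by (rule has_field_derivative_transform_within_open[where S = "{..<0}"]) (use less in auto)
next
  case equal
  have "((\<lambda>h::real. max 0 h) \<longlongrightarrow> max 0 0) (at 0)"
    by (intro tendsto_intros)
  \<comment> \<open>At the kink the difference quotient of the squared positive part is
    \<open>max 0 h\<close> itself, so the derivative there is 0.\<close>
  moreover have "max 0 h = (max 0 h)\<^sup>2 / h" if "h \<noteq> 0" for h :: real
    using that by (auto simp: max_def power2_eq_square)
  ultimately have "((\<lambda>h::real. (max 0 h)\<^sup>2 / h) \<longlongrightarrow> 0) (at 0)"
    by (smt (verit) Lim_cong_within)
  then show ?thesis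
    using equal by (simp add: has_field_derivative_iff)
next
  case greater
  have "((\<lambda>t::real. t\<^sup>2) has_real_derivative 2 * max 0 t) (at t)"
    using greater by (auto intro!: derivative_eq_intros)
  then show ?thesis
    by (rule has_field_derivative_transform_within_open[where S = "{0<..}"]) (use greater in auto)
qed

lemma GDERIV_sum:
  assumes "\<And>i. i \<in> I \<Longrightarrow> GDERIV (f i) x :> f' i"
  shows "GDERIV (\<lambda>y. \<Sum>i\<in>I. f i y) x :> (\<Sum>i\<in>I. f' i)"
  using assms unfolding gderiv_def inner_sum_right by (rule has_derivative_sum)

lemma GDERIV_dist_squared:
  fixes z :: "'a::real_inner"
  shows "GDERIV (\<lambda>y. (dist y z)\<^sup>2) x :> 2 *\<^sub>R (x - z)"
proof -
  have "((\<lambda>y. (y - z) \<bullet> (y - z)) has_derivative (\<lambda>h. (x - z) \<bullet> h + h \<bullet> (x - z))) (at x)"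
    by (auto intro!: derivative_eq_intros)
  then show ?thesis
    by (simp add: gderiv_def dist_norm power2_norm_eq_inner inner_commute)
qed

lemma GDERIV_local_min_zero:
  assumes "GDERIV f x :> d" "open S" "x \<in> S" "\<And>y. y \<in> S \<Longrightarrow> f x \<le> f y"
  shows "d = 0"
proof -
  have "(\<lambda>h. h \<bullet> d) = (\<lambda>h. 0)"
    using differential_zero_maxmin[OF assms(3,2)] assms(1,4) unfolding gderiv_def by blast
  then show ?thesis
    by (metis inner_eq_zero_iff)
qed

text \<open>For large \<open>k\<close> the penalized function exceeds \<open>f z\<close>, its value
  at \<open>z\<close>, on the whole sphere. Its minimizer over the closed ball is therefore
  interior, and the vanishing gradient there is the multiplier equation. The equation is exact, but
  it holds at a point \<open>x\<close> near \<open>z\<close> and carries the gradient of the squared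
  distance as an extra term.\<close>

lemma approximate_KKT:
  fixes f :: "'a::euclidean_space \<Rightarrow> real"
  assumes "finite I" "0 < r"
    and df: "\<And>x. x \<in> cball z r \<Longrightarrow> GDERIV f x :> f' x"
    and dc: "\<And>i x. i \<in> I \<Longrightarrow> x \<in> cball z r \<Longrightarrow> GDERIV (c i) x :> c' i x"
    and z: "\<And>i. i \<in> I \<Longrightarrow> c i z = 0"
    and min: "\<And>x. x \<in> cball z r \<Longrightarrow> \<forall>i\<in>I. c i x \<le> 0 \<and> (i \<in> E \<longrightarrow> c i x = 0) \<Longrightarrow> f z \<le> f x"
  obtains x lam where "x \<in> ball z r" "\<forall>i\<in>I - E. 0 \<le> lam i"
    "f' x + 2 *\<^sub>R (x - z) + (\<Sum>i\<in>I. lam i *\<^sub>R c' i x) = 0"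
proof -
  \<comment> \<open>The violation keeps its sign for equations and is the positive part for
    inequalities. It reappears as a factor of the multiplier, which explains the sign pattern on
    \<open>I - E\<close>.\<close>
  define psi where "psi i t = (if i \<in> E then t else max 0 t)" for i and t :: real
  define pen where "pen x = (\<Sum>i\<in>I. (psi i (c i x))\<^sup>2)" for x
  \<comment> \<open>The squared distance makes \<open>z\<close> the strict minimizer among the
    admissible points of the ball, even if \<open>f\<close> has other minimizers there.\<close>
  define F where "F k x = f x + (dist x z)\<^sup>2 + k * pen x" for k x
  have psi: "((\<lambda>t. (psi i t)\<^sup>2) has_real_derivative 2 * psi i t) (at t)" for i t
    unfolding psi_def by (auto intro!: derivative_eq_intros has_real_derivative_max_0_squared)
  have dpsi: "GDERIV (\<lambda>y. (psi i (c i y))\<^sup>2) x :> (2 * psi i (c i x)) *\<^sub>R c' i x"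
    if "i \<in> I" "x \<in> cball z r" for i x
    by (rule GDERIV_DERIV_compose[OF dc[OF that] psi])
  have dpen: "GDERIV pen x :> (\<Sum>i\<in>I. (2 * psi i (c i x)) *\<^sub>R c' i x)" if "x \<in> cball z r" for x
    unfolding pen_def using that by (intro GDERIV_sum dpsi)
  have dF: "GDERIV (F k) x :> f' x + 2 *\<^sub>R (x - z) +
      k *\<^sub>R (\<Sum>i\<in>I. (2 * psi i (c i x)) *\<^sub>R c' i x)" if "x \<in> cball z r" for k x
    unfolding F_def
    using GDERIV_add[OF GDERIV_add[OF df[OF that] GDERIV_dist_squared]
        GDERIV_mult[OF GDERIV_const dpen[OF that]]] by simp
  have cont: "continuous_on (cball z r) (F k)" for k
    using dF unfolding gderiv_def
    by (meson continuous_at_imp_continuous_on has_derivative_continuous)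
  have Fz: "F k z = f z" for k
  proof -
    have "pen z = 0"
      unfolding pen_def by (rule sum.neutral) (simp add: psi_def z)
    then show ?thesis by (simp add: F_def)
  qed
  have pen_nonneg: "0 \<le> pen x" for x
    unfolding pen_def by (simp add: sum_nonneg)
  have pen_zero: "f z \<le> f x" if "pen x = 0" "x \<in> cball z r" for x
  proof (rule min[OF that(2)])
    have "\<forall>i\<in>I. psi i (c i x) = 0"
      using that(1) \<open>finite I\<close> unfolding pen_def by (simp add: sum_nonneg_eq_0_iff)
    then show "\<forall>i\<in>I. c i x \<le> 0 \<and> (i \<in> E \<longrightarrow> c i x = 0)"
      unfolding psi_def by (metis max.cobounded2 order_refl)
  qed
  \<comment> \<open>Otherwise the sets \<open>B k\<close> are nonempty, compact and decreasing, so
    they share a point. There \<open>k * pen x\<close> stays bounded for all \<open>k\<close>, hence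
    \<open>pen x = 0\<close> and \<open>x\<close> is admissible. Then \<open>f z\<close> is at most
    \<open>f x\<close>, while membership in \<open>B 0\<close> bounds \<open>f x\<close> plus the
    square of \<open>r\<close> by \<open>f z\<close>.\<close>
  have "\<exists>k::nat. \<forall>x\<in>sphere z r. f z < F k x"
  proof (rule ccontr)
    assume neg: "\<not> ?thesis"
    define B where "B k = {x \<in> sphere z r. F (real k) x \<le> f z}" for k
    have "\<Inter>(range B) \<noteq> {}"
    proof (rule compact_nest)
      fix n
      have "continuous_on (sphere z r) (F (real n))"
        using cont by (rule continuous_on_subset) auto
      then have "closed (sphere z r \<inter> F (real n) -` {..f z})"
        by (rule continuous_closed_preimage) auto
      moreover have "B n = sphere z r \<inter> (sphere z r \<inter> F (real n) -` {..f z})"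
        unfolding B_def by auto
      ultimately show "compact (B n)"
        by (metis compact_Int_closed compact_sphere)
      show "B n \<noteq> {}"
        using neg unfolding B_def by (simp add: not_less Bex_def)
    next
      fix m n :: nat
      assume "m \<le> n"
      then have "F (real m) x \<le> F (real n) x" for x
        unfolding F_def using pen_nonneg by (simp add: mult_right_mono)
      then show "B n \<subseteq> B m"
        unfolding B_def by (auto intro: order_trans)
    qed
    then obtain x where x: "\<And>k. x \<in> B k" by blast
    have sph: "x \<in> sphere z r" using x unfolding B_def by auto
    have bd: "real k * pen x \<le> f z - f x" for k
    proof -
      have "f x + (dist x z)\<^sup>2 + real k * pen x \<le> f z"
        using x[of k] by (simp add: B_def F_def)
      then show ?thesis using zero_le_power2[of "dist x z"] by linarith
    qed
    have "pen x = 0"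
    proof (rule ccontr)
      assume "pen x \<noteq> 0"
      then have "0 < pen x" using pen_nonneg[of x] by simp
      then obtain k where "f z - f x < real k * pen x"
        using ex_less_of_nat_mult by blast
      then show False using bd[of k] by simp
    qed
    moreover have "dist x z = r" using sph by (simp add: dist_commute)
    ultimately have "f x + r\<^sup>2 \<le> f z" "f z \<le> f x"
      using x[of 0] pen_zero[of x] sph unfolding B_def F_def by auto
    then show False using \<open>0 < r\<close> by (smt (verit) zero_less_power)
  qed
  then obtain k :: nat where k: "\<And>x. x \<in> sphere z r \<Longrightarrow> f z < F k x" by blast
  obtain x where x: "x \<in> cball z r" "\<And>y. y \<in> cball z r \<Longrightarrow> F k x \<le> F k y"
    using continuous_attains_inf[OF compact_cball _ cont[of "real k"]] \<open>0 < r\<close> by fastforce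
  have "F k x \<le> f z" using x(2)[of z] \<open>0 < r\<close> Fz by simp
  then have xb: "x \<in> ball z r"
    using x(1) k[of x] by (smt (verit) mem_ball mem_cball mem_sphere)
  have "f' x + 2 *\<^sub>R (x - z) + real k *\<^sub>R (\<Sum>i\<in>I. (2 * psi i (c i x)) *\<^sub>R c' i x) = 0"
    using GDERIV_local_min_zero[OF dF[OF x(1)] open_ball xb] x(2) by auto
  then have "f' x + 2 *\<^sub>R (x - z) + (\<Sum>i\<in>I. (real k * (2 * psi i (c i x))) *\<^sub>R c' i x) = 0"
    by (simp add: scaleR_sum_right)
  moreover have "\<forall>i\<in>I - E. 0 \<le> real k * (2 * psi i (c i x))"
    by (auto simp: psi_def)
  ultimately show thesis by (intro that[OF xb])
qed

section \<open>Passing to the limit in the multiplier equation\<close>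

lemma finite_family_convergent_subsequence:
  fixes u :: "nat \<Rightarrow> 'i \<Rightarrow> real"
  assumes "finite I" "\<And>i. i \<in> I \<Longrightarrow> bounded (range (\<lambda>n. u n i))"
  obtains r l where "strict_mono (r :: nat \<Rightarrow> nat)" "\<And>i. i \<in> I \<Longrightarrow> (\<lambda>n. u (r n) i) \<longlonglongrightarrow> l i"
proof -
  have "\<exists>r. strict_mono (r :: nat \<Rightarrow> nat) \<and> (\<forall>i\<in>I. convergent (\<lambda>n. u (r n) i))"
    using assms
  proof (induction I rule: finite_induct)
    case empty
    show ?case using strict_mono_id by auto
  next
    case (insert j I)
    then obtain r :: "nat \<Rightarrow> nat"
      where r: "strict_mono r" "\<forall>i\<in>I. convergent (\<lambda>n. u (r n) i)" by auto
    \<comment> \<open>One further refinement makes coordinate \<open>j\<close> converge; the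
      coordinates already treated keep their limits along a subsequence.\<close>
    have "bounded (range (\<lambda>n. u (r n) j))"
      using insert.prems[of j] by (auto elim: bounded_subset)
    then obtain l s where s: "strict_mono (s :: nat \<Rightarrow> nat)" "((\<lambda>n. u (r n) j) \<circ> s) \<longlonglongrightarrow> l"
      using bounded_imp_convergent_subsequence by blast
    have "convergent (\<lambda>n. u ((r \<circ> s) n) i)" if "i \<in> insert j I" for i
    proof (cases "i = j")
      case True
      then show ?thesis using s(2) by (auto simp: convergent_def o_def)
    next
      case False
      then have "convergent (\<lambda>n. u (r n) i)" using r(2) that by auto
      from convergent_subseq_convergent[OF this s(1)] show ?thesis by (simp add: o_def)
    qed
    then show ?case using strict_mono_o[OF r(1) s(1)] by blast
  qed
  then show thesis using that unfolding convergent_def by metis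
qed

text \<open>The coefficients \<open>lam n\<close> may a priori be unbounded, so compactness is
  applied to normalized coefficients. Positive linear independence of the limit vectors
  \<open>b\<close> ensures that the normalization can be undone in the limit.\<close>

lemma limit_of_positive_combinations:
  fixes a :: "nat \<Rightarrow> 'i \<Rightarrow> 'a::real_normed_vector"
  assumes "finite I"
    and a: "\<And>i. i \<in> I \<Longrightarrow> (\<lambda>n. a n i) \<longlonglongrightarrow> b i"
    and v: "v \<longlonglongrightarrow> w"
    and comb: "\<And>n. (\<Sum>i\<in>I. lam n i *\<^sub>R a n i) = v n"
    and nonneg: "\<And>n i. i \<in> I - E \<Longrightarrow> 0 \<le> lam n i"
    and indep: "\<And>mu. \<forall>i\<in>I - E. 0 \<le> mu i \<Longrightarrow> (\<Sum>i\<in>I. mu i *\<^sub>R b i) = 0 \<Longrightarrow> \<forall>i\<in>I. mu i = 0"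
  obtains mu where "\<forall>i\<in>I - E. 0 \<le> mu i" "(\<Sum>i\<in>I. mu i *\<^sub>R b i) = w"
proof -
  \<comment> \<open>The summand 1 keeps \<open>t n\<close> positive and yields
    \<open>1 / t n\<close> as 1 minus the sum of the absolute normalized coefficients. The limit of
    \<open>1 / t\<close> is thus determined by the limits \<open>l i\<close>.\<close>
  define t where "t n = 1 + (\<Sum>i\<in>I. \<bar>lam n i\<bar>)" for n
  define u where "u n i = lam n i / t n" for n i
  have t: "0 < t n" for n
    unfolding t_def by (smt (verit) sum_nonneg abs_ge_zero)
  have "\<bar>u n i\<bar> \<le> 1" if "i \<in> I" for n i
    using member_le_sum[OF that, of "\<lambda>i. \<bar>lam n i\<bar>"] \<open>finite I\<close> t[of n]
    by (simp add: u_def t_def)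
  then have "bounded (range (\<lambda>n. u n i))" if "i \<in> I" for i
    using that by (auto simp: bounded_iff)
  then obtain r l where r: "strict_mono (r :: nat \<Rightarrow> nat)"
    and l: "\<And>i. i \<in> I \<Longrightarrow> (\<lambda>n. u (r n) i) \<longlonglongrightarrow> l i"
    using finite_family_convergent_subsequence[OF \<open>finite I\<close>] by blast
  \<comment> \<open>\<open>s\<close> is the limiting weight of \<open>w\<close> after normalization; \<open>s = 0\<close> would violate \<open>indep\<close>.\<close>
  define s where "s = 1 - (\<Sum>i\<in>I. \<bar>l i\<bar>)"
  have inv_t: "1 / t n = 1 - (\<Sum>i\<in>I. \<bar>u n i\<bar>)" for n
    using t[of n] unfolding u_def
    by (simp add: sum_divide_distrib[symmetric] abs_divide field_simps) (simp add: t_def)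
  have s: "(\<lambda>n. 1 / t (r n)) \<longlonglongrightarrow> s"
    unfolding inv_t s_def by (intro tendsto_intros l)
  have "0 \<le> s"
    using s by (rule tendsto_lowerbound) (simp_all add: t less_imp_le)
  have l_nonneg: "0 \<le> l i" if "i \<in> I - E" for i
  proof (rule tendsto_lowerbound[OF l])
    show "\<forall>\<^sub>F n in sequentially. 0 \<le> u (r n) i"
      using nonneg[OF that] t by (simp add: u_def less_imp_le)
  qed (use that in auto)
  have "(\<lambda>n. \<Sum>i\<in>I. u (r n) i *\<^sub>R a (r n) i) \<longlonglongrightarrow> (\<Sum>i\<in>I. l i *\<^sub>R b i)"
    using LIMSEQ_subseq_LIMSEQ[OF a r] by (intro tendsto_intros l) (auto simp: o_def)
  moreover have "(\<Sum>i\<in>I. u n i *\<^sub>R a n i) = (1 / t n) *\<^sub>R v n" for n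
    unfolding comb[symmetric] scaleR_sum_right by (simp add: u_def)
  moreover have "(\<lambda>n. (1 / t (r n)) *\<^sub>R v (r n)) \<longlonglongrightarrow> s *\<^sub>R w"
    using LIMSEQ_subseq_LIMSEQ[OF v r] by (intro tendsto_intros s) (auto simp: o_def)
  ultimately have sum_l: "(\<Sum>i\<in>I. l i *\<^sub>R b i) = s *\<^sub>R w"
    using LIMSEQ_unique by fastforce
  have "s \<noteq> 0"
  proof
    assume "s = 0"
    then have "\<forall>i\<in>I. l i = 0" using indep[of l] l_nonneg sum_l by auto
    then show False using \<open>s = 0\<close> unfolding s_def by simp
  qed
  then have "(\<Sum>i\<in>I. (l i / s) *\<^sub>R b i) = w"
    using arg_cong[OF sum_l, of "\<lambda>x. (1 / s) *\<^sub>R x"] by (simp add: scaleR_sum_right)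
  moreover have "\<forall>i\<in>I - E. 0 \<le> l i / s"
    using l_nonneg \<open>0 \<le> s\<close> by simp
  ultimately show thesis by (intro that)
qed

text \<open>A coefficient of free sign amounts to having both \<open>a i\<close> and
  \<open>- a i\<close> as generators. The set is therefore a finitely generated convex cone, and
  such cones are closed.\<close>

lemma closed_positive_combinations:
  fixes a :: "'i \<Rightarrow> 'a::euclidean_space"
  assumes "finite I"
  shows "closed {\<Sum>i\<in>I. lam i *\<^sub>R a i | lam. \<forall>i\<in>I - E. 0 \<le> lam i}" (is "closed ?C")
proof -
  define S where "S = a ` I \<union> (\<lambda>i. - a i) ` (I \<inter> E)"
  have "?C = convex_cone hull S"
  proof
    have single: "c *\<^sub>R a i \<in> ?C" if "i \<in> I" "i \<in> E \<or> 0 \<le> c" for c i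
    proof -
      have "(\<Sum>j\<in>I. (if j = i then c else 0) *\<^sub>R a j) = c *\<^sub>R a i"
        using that \<open>finite I\<close> by (simp add: if_distrib[of "\<lambda>c. c *\<^sub>R _"] sum.delta cong: if_cong)
      then show ?thesis using that
        by (intro CollectI exI[of _ "\<lambda>j. if j = i then c else 0"]) auto
    qed
    have "S \<subseteq> ?C"
      using single[of _ 1] single[of _ "-1"] unfolding S_def by auto
    moreover have "convex_cone ?C"
      unfolding convex_cone_iff
    proof (intro conjI ballI allI impI)
      show "0 \<in> ?C" by (intro CollectI exI[of _ "\<lambda>i. 0"]) auto
    next
      fix x y assume "x \<in> ?C" "y \<in> ?C"
      then obtain l m where "x = (\<Sum>i\<in>I. l i *\<^sub>R a i)" "y = (\<Sum>i\<in>I. m i *\<^sub>R a i)"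
        "\<forall>i\<in>I - E. 0 \<le> l i" "\<forall>i\<in>I - E. 0 \<le> m i" by auto
      then show "x + y \<in> ?C"
        by (intro CollectI exI[of _ "\<lambda>i. l i + m i"]) (auto simp: scaleR_add_left sum.distrib)
    next
      fix x and c :: real assume "x \<in> ?C" "0 \<le> c"
      then obtain l where "x = (\<Sum>i\<in>I. l i *\<^sub>R a i)" "\<forall>i\<in>I - E. 0 \<le> l i" by auto
      then show "c *\<^sub>R x \<in> ?C" using \<open>0 \<le> c\<close>
        by (intro CollectI exI[of _ "\<lambda>i. c * l i"]) (auto simp: scaleR_sum_right)
    qed
    ultimately show "convex_cone hull S \<subseteq> ?C" by (rule hull_minimal)
  next
    have mem: "c *\<^sub>R a i \<in> convex_cone hull S" if "i \<in> I" "i \<in> E \<or> 0 \<le> c" for i c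
    proof (cases "0 \<le> c")
      case True
      then show ?thesis
        using that by (intro convex_cone_hull_mul hull_inc) (auto simp: S_def)
    next
      \<comment> \<open>A negative coefficient occurs only for \<open>i\<close> in \<open>E\<close>,
        where \<open>- a i\<close> is a generator as well.\<close>
      case False
      then have "(- c) *\<^sub>R (- a i) \<in> convex_cone hull S"
        using that by (intro convex_cone_hull_mul hull_inc) (auto simp: S_def)
      then show ?thesis by simp
    qed
    have "(\<Sum>i\<in>J. lam i *\<^sub>R a i) \<in> convex_cone hull S"
      if "J \<subseteq> I" "finite J" "\<forall>i\<in>I - E. 0 \<le> lam i" for J lam
      using that(2,1)
      by (induction J rule: finite_induct)
        (use that(3) in \<open>auto intro!: convex_cone_hull_add mem simp: convex_cone_hull_contains_0\<close>)
    then show "?C \<subseteq> convex_cone hull S" using \<open>finite I\<close> by auto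
  qed
  moreover have "finite S" using \<open>finite I\<close> unfolding S_def by simp
  ultimately show ?thesis by (simp add: closed_convex_cone_hull)
qed

text \<open>Shrinking balls give approximate multipliers at points tending to \<open>z\<close>. The
  alternatives in \<open>CQ\<close> are two ways to take the limit: positive linear independence
  controls the multipliers themselves, whereas constant gradients keep all their combinations in one
  closed cone.\<close>

lemma KKT_conditions:
  fixes f :: "'a::euclidean_space \<Rightarrow> real"
  assumes "finite I" "0 < r"
    and df: "\<And>x. x \<in> cball z r \<Longrightarrow> GDERIV f x :> f' x"
    and dc: "\<And>i x. i \<in> I \<Longrightarrow> x \<in> cball z r \<Longrightarrow> GDERIV (c i) x :> c' i x"
    and contf: "isCont f' z"
    and contc: "\<And>i. i \<in> I \<Longrightarrow> isCont (c' i) z"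
    and z: "\<And>i. i \<in> I \<Longrightarrow> c i z = 0"
    and min: "\<And>x. x \<in> cball z r \<Longrightarrow> \<forall>i\<in>I. c i x \<le> 0 \<and> (i \<in> E \<longrightarrow> c i x = 0) \<Longrightarrow> f z \<le> f x"
    and CQ: "(\<forall>mu. (\<forall>i\<in>I - E. 0 \<le> mu i) \<longrightarrow> (\<Sum>i\<in>I. mu i *\<^sub>R c' i z) = 0 \<longrightarrow> (\<forall>i\<in>I. mu i = 0))
      \<or> (\<forall>i\<in>I. \<forall>x. c' i x = c' i z)"
  obtains mu where "\<forall>i\<in>I - E. 0 \<le> mu i" "f' z + (\<Sum>i\<in>I. mu i *\<^sub>R c' i z) = 0"
proof -
  have "\<exists>x lam. x \<in> ball z (r / Suc n) \<and> (\<forall>i\<in>I - E. 0 \<le> lam i) \<and>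
      f' x + 2 *\<^sub>R (x - z) + (\<Sum>i\<in>I. lam i *\<^sub>R c' i x) = 0" for n
  proof -
    have pos: "0 < r / Suc n" and le: "r / Suc n \<le> r"
      using \<open>0 < r\<close> by (auto simp: field_simps)
    have sub: "x \<in> cball z r" if "x \<in> cball z (r / Suc n)" for x
      using that le by (simp only: mem_cball)
    show ?thesis
      by (rule approximate_KKT[OF \<open>finite I\<close> pos, of z f f' c c' E]) (use df dc z min sub in blast)+
  qed
  then obtain x lam where x: "\<And>n. x n \<in> ball z (r / Suc n)"
    and lam: "\<And>n. \<forall>i\<in>I - E. 0 \<le> lam n i"
    and eq: "\<And>n. f' (x n) + 2 *\<^sub>R (x n - z) + (\<Sum>i\<in>I. lam n i *\<^sub>R c' i (x n)) = 0"
    by metis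
  have r0: "(\<lambda>n. r / Suc n) \<longlonglongrightarrow> 0"
    using LIMSEQ_Suc[OF lim_const_over_n[of r]] by simp
  have le: "dist (x n) z \<le> r / Suc n" for n
    using x[of n] by (simp add: dist_commute less_imp_le)
  have "(\<lambda>n. dist (x n) z) \<longlonglongrightarrow> 0"
    by (rule tendsto_sandwich[OF _ _ tendsto_const r0]) (use le in \<open>auto simp del: of_nat_Suc\<close>)
  then have lim: "x \<longlonglongrightarrow> z"
    by (rule tendsto_dist_iff[THEN iffD2])
  \<comment> \<open>\<open>v n\<close> is what the constraint gradients have to produce; it tends to
    \<open>- f' z\<close> because the distance term vanishes in the limit.\<close>
  define v where "v n = - (f' (x n) + 2 *\<^sub>R (x n - z))" for n
  have comb: "(\<Sum>i\<in>I. lam n i *\<^sub>R c' i (x n)) = v n" for n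
    using eq[of n] unfolding v_def by (metis add.commute eq_neg_iff_add_eq_0)
  have "v \<longlonglongrightarrow> - (f' z + 2 *\<^sub>R (z - z))"
    unfolding v_def by (intro tendsto_intros lim isCont_tendsto_compose[OF contf])
  then have v: "v \<longlonglongrightarrow> - f' z" by simp
  have "\<exists>mu. (\<forall>i\<in>I - E. 0 \<le> mu i) \<and> (\<Sum>i\<in>I. mu i *\<^sub>R c' i z) = - f' z"
    using CQ
  proof
    assume indep: "\<forall>mu. (\<forall>i\<in>I - E. 0 \<le> mu i) \<longrightarrow> (\<Sum>i\<in>I. mu i *\<^sub>R c' i z) = 0 \<longrightarrow> (\<forall>i\<in>I. mu i = 0)"
    have a: "(\<lambda>n. c' i (x n)) \<longlonglongrightarrow> c' i z" if "i \<in> I" for i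
      by (rule isCont_tendsto_compose[OF contc[OF that] lim])
    show ?thesis
    proof (rule limit_of_positive_combinations[OF \<open>finite I\<close> a v comb, of E])
      show "0 \<le> lam n i" if "i \<in> I - E" for n i
        using lam that by blast
      show "\<forall>i\<in>I. mu i = 0"
        if "\<forall>i\<in>I - E. 0 \<le> mu i" "(\<Sum>i\<in>I. mu i *\<^sub>R c' i z) = 0" for mu
        using indep that by simp
    qed auto
  next
    assume const: "\<forall>i\<in>I. \<forall>x. c' i x = c' i z"
    \<comment> \<open>All \<open>v n\<close> lie in the same cone, so closedness gives a
      representation of the limit even if the coefficients \<open>lam n\<close> diverge.\<close>
    have "(\<Sum>i\<in>I. lam n i *\<^sub>R c' i z) = v n" for n
      unfolding comb[symmetric] by (intro sum.cong refl arg_cong[where f = "scaleR _"]) (metis const)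
    then have "v n \<in> {\<Sum>i\<in>I. lam i *\<^sub>R c' i z | lam. \<forall>i\<in>I - E. 0 \<le> lam i}" for n
      using lam[of n] by (intro CollectI exI[of _ "lam n"]) simp
    then have "- f' z \<in> {\<Sum>i\<in>I. lam i *\<^sub>R c' i z | lam. \<forall>i\<in>I - E. 0 \<le> lam i}"
      by (rule closed_sequentially[OF closed_positive_combinations[OF \<open>finite I\<close>] _ v])
    then show ?thesis unfolding mem_Collect_eq by metis
  qed
  then show thesis using that by (metis add.right_inverse)
qed

section \<open>Gradients of the functions of the program\<close>

lemma GDERIV_gradient:
  fixes \<phi> :: "real ^ 'n::finite \<Rightarrow> real"
  assumes "\<phi> differentiable (at x)"
  shows "GDERIV \<phi> x :> gradient \<phi> x"
proof -
  obtain D where D: "(\<phi> has_derivative D) (at x)"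
    using assms unfolding differentiable_def by blast
  then have "linear D" by (rule has_derivative_linear)
  \<comment> \<open>Riesz representation: the functional \<open>D\<close> is the inner product with
    \<open>adjoint D 1\<close>, so the definite description in \<open>gradient\<close>
    denotes.\<close>
  then have "D = (\<lambda>h. h \<bullet> adjoint D 1)"
    by (simp add: fun_eq_iff adjoint_works)
  then have "GDERIV \<phi> x :> adjoint D 1"
    using D unfolding gderiv_def by simp
  then show ?thesis using gradient_eqI by metis
qed

lemma cont_differentiable_at_tendsto:
  assumes "cont_differentiable_at \<phi> z"
  shows "(\<phi> \<longlongrightarrow> \<phi> z) (nhds z)"
proof -
  have "\<phi> differentiable (at z)"
    using assms eventually_nhds_x_imp_x unfolding cont_differentiable_at_def by blast
  then have "isCont \<phi> z" by (rule differentiable_imp_continuous_within)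
  then show ?thesis by (simp add: isCont_def tendsto_at_iff_tendsto_nhds)
qed

text \<open>Supplies the second alternative of \<open>CQ\<close> in
  \<open>KKT_conditions\<close>.\<close>

lemma gradient_affine_const:
  fixes \<phi> :: "real ^ 'n::finite \<Rightarrow> real"
  assumes "affine_function \<phi>"
  shows "gradient \<phi> x = gradient \<phi> y"
proof -
  obtain a b where ab: "\<phi> = (\<lambda>x. a \<bullet> x + b)"
    using assms unfolding affine_function_def by blast
  have "GDERIV \<phi> x :> a" for x
    unfolding ab gderiv_def by (auto intro!: derivative_eq_intros simp: inner_commute)
  then have "gradient \<phi> x = a" for x by (rule gradient_eqI)
  then show ?thesis by simp
qed

section \<open>The branch as an ordinary nonlinear program\<close>

datatype constr = Cg nat | Ch nat | CG nat | CH nat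

text \<open>\<open>KKT_conditions\<close> takes a single family of constraints, so the four families
  are merged by tagging their indices.\<close>

primrec constr_fun :: "('n::finite) mpvc \<Rightarrow> constr \<Rightarrow> real ^ 'n \<Rightarrow> real" where
  "constr_fun P (Cg i) = con_g P i"
| "constr_fun P (Ch i) = con_h P i"
| "constr_fun P (CG i) = con_G P i"
| "constr_fun P (CH i) = (\<lambda>x. - con_H P i x)"

primrec constr_grad :: "('n::finite) mpvc \<Rightarrow> constr \<Rightarrow> real ^ 'n \<Rightarrow> real ^ 'n" where
  "constr_grad P (Cg i) = gradient (con_g P i)"
| "constr_grad P (Ch i) = gradient (con_h P i)"
| "constr_grad P (CG i) = gradient (con_G P i)"
| "constr_grad P (CH i) = (\<lambda>x. - gradient (con_H P i) x)"

text \<open>Every constraint of the branch has the form \<open>\<le> 0\<close>, hence the sign in the \<open>CH\<close> case above; the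
  elements of \<open>branch_eq\<close> are imposed as equations.\<close>

definition branch :: "('n::finite) mpvc \<Rightarrow> real ^ 'n \<Rightarrow> constr set" where
  "branch P z = Cg ` I_g P z \<union> Ch ` {1..num_h P} \<union> CG ` I_plus_zero P z \<union>
     CH ` (I_zero_zero P z \<union> I_zero_plus P z \<union> I_zero_minus P z)"

definition branch_eq :: "('n::finite) mpvc \<Rightarrow> real ^ 'n \<Rightarrow> constr set" where
  "branch_eq P z = Ch ` {1..num_h P} \<union> CH ` (I_zero_zero P z \<union> I_zero_plus P z)"

lemmas index_set_defs = I_g_def I_plus_def I_plus_zero_def I_plus_minus_def
  I_zero_zero_def I_zero_plus_def I_zero_minus_def

text \<open>KKT multipliers are determined only on the branch, while the sign conditions and the
  gradient sum of the MPVC range over all indices. This cutoff makes the remaining constraints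
  contribute nothing.\<close>

definition branch_mult :: "('n::finite) mpvc \<Rightarrow> real ^ 'n \<Rightarrow> (constr \<Rightarrow> real) \<Rightarrow> constr \<Rightarrow> real" where
  "branch_mult P z mu j = (if j \<in> branch P z then mu j else 0)"

lemma branch_iff [simp]:
  "Cg i \<in> branch P z \<longleftrightarrow> i \<in> I_g P z"
  "Ch i \<in> branch P z \<longleftrightarrow> i \<in> {1..num_h P}"
  "CG i \<in> branch P z \<longleftrightarrow> i \<in> I_plus_zero P z"
  "CH i \<in> branch P z \<longleftrightarrow> i \<in> I_zero_zero P z \<or> i \<in> I_zero_plus P z \<or> i \<in> I_zero_minus P z"
  unfolding branch_def by blast+

lemma branch_eq_iff [simp]:
  "Cg i \<notin> branch_eq P z"
  "Ch i \<in> branch_eq P z \<longleftrightarrow> i \<in> {1..num_h P}"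
  "CG i \<notin> branch_eq P z"
  "CH i \<in> branch_eq P z \<longleftrightarrow> i \<in> I_zero_zero P z \<or> i \<in> I_zero_plus P z"
  unfolding branch_eq_def by blast+

lemma branch_subset:
  "branch P z \<subseteq> Cg ` {1..num_g P} \<union> Ch ` {1..num_h P} \<union> CG ` {1..num_GH P} \<union> CH ` {1..num_GH P}"
  unfolding branch_def by (intro Un_mono image_mono) (auto simp: index_set_defs)

lemma finite_branch: "finite (branch P z)"
  using branch_subset by (rule finite_subset) (intro finite_UnI finite_imageI finite_atLeastAtMost)

lemma branch_cases:
  assumes "j \<in> branch P z"
  obtains i where "j = Cg i" "i \<in> {1..num_g P}" | i where "j = Ch i" "i \<in> {1..num_h P}"
    | i where "j = CG i" "i \<in> {1..num_GH P}" | i where "j = CH i" "i \<in> {1..num_GH P}"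
  using subsetD[OF branch_subset assms] by blast

lemma branch_multiplier_sum:
  "(\<Sum>j\<in>branch P z. mu j *\<^sub>R constr_grad P j x) =
    constraint_gradient_sum P x (\<lambda>i. branch_mult P z mu (Cg i)) (\<lambda>i. branch_mult P z mu (Ch i))
      (\<lambda>i. branch_mult P z mu (CG i)) (\<lambda>i. branch_mult P z mu (CH i))"
proof -
  let ?m = "branch_mult P z mu"
  let ?A = "Cg ` {1..num_g P}" and ?B = "Ch ` {1..num_h P}"
    and ?C = "CG ` {1..num_GH P}" and ?D = "CH ` {1..num_GH P}"
  have "(\<Sum>j\<in>branch P z. mu j *\<^sub>R constr_grad P j x) =
      (\<Sum>j\<in>branch P z. ?m j *\<^sub>R constr_grad P j x)"
    by (simp add: branch_mult_def)
  also have "\<dots> = (\<Sum>j\<in>?A \<union> ?B \<union> ?C \<union> ?D. ?m j *\<^sub>R constr_grad P j x)"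
    by (rule sum.mono_neutral_left[OF _ branch_subset]) (simp_all add: branch_mult_def)
  also have "\<dots> = (\<Sum>j\<in>?A. ?m j *\<^sub>R constr_grad P j x) + (\<Sum>j\<in>?B. ?m j *\<^sub>R constr_grad P j x) +
      (\<Sum>j\<in>?C. ?m j *\<^sub>R constr_grad P j x) + (\<Sum>j\<in>?D. ?m j *\<^sub>R constr_grad P j x)"
    by (subst sum.union_disjoint, auto)+
  finally show ?thesis
    by (simp add: constraint_gradient_sum_def sum.reindex inj_on_def sum_negf)
qed

text \<open>Here the choice of branch pays off. For biactive \<open>i\<close>, \<open>CG i\<close>
  is outside the branch, so \<open>etaG i = 0\<close> and complementarity holds. The multipliers
  \<open>etaH\<close> of free sign belong to the \<open>CH\<close> equations.\<close>

lemma branch_multiplier_signs: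
  assumes "\<forall>j\<in>branch P z - branch_eq P z. 0 \<le> mu j"
  shows "M_sign_conditions P z (\<lambda>i. branch_mult P z mu (Cg i)) (\<lambda>i. branch_mult P z mu (Ch i))
      (\<lambda>i. branch_mult P z mu (CG i)) (\<lambda>i. branch_mult P z mu (CH i))"
proof -
  have nonneg: "0 \<le> branch_mult P z mu j" if "j \<notin> branch_eq P z" for j
    using assms that by (simp add: branch_mult_def)
  have zero: "branch_mult P z mu j = 0" if "j \<notin> branch P z" for j
    using that by (simp add: branch_mult_def)
  show ?thesis
    unfolding M_sign_conditions_def
    \<comment> \<open>Each conjunct is a sign off \<open>branch_eq\<close>, a zero off
      \<open>branch\<close>, or the product whose second factor is zero.\<close>
    by (intro conjI ballI; (rule nonneg | rule zero | simp, rule disjI2, rule zero))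
      (auto simp: index_set_defs)
qed

text \<open>Cutting off a branch multiplier gives a candidate excluded by GMFCQ unless it is zero.
  This is the positive linear independence required by \<open>KKT_conditions\<close>.\<close>

lemma MPVC_GMFCQ_branch:
  assumes "MPVC_GMFCQ P z" "\<forall>j\<in>branch P z - branch_eq P z. 0 \<le> mu j"
    "(\<Sum>j\<in>branch P z. mu j *\<^sub>R constr_grad P j z) = 0"
  shows "\<forall>j\<in>branch P z. mu j = 0"
proof -
  have "\<not> nonzero_multiplier P (\<lambda>i. branch_mult P z mu (Cg i)) (\<lambda>i. branch_mult P z mu (Ch i))
      (\<lambda>i. branch_mult P z mu (CG i)) (\<lambda>i. branch_mult P z mu (CH i))"
    using assms(1) branch_multiplier_signs[OF assms(2)] assms(3)[unfolded branch_multiplier_sum]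
    unfolding MPVC_GMFCQ_def by blast
  then have "branch_mult P z mu j = 0" if "j \<in> branch P z" for j
    using that unfolding nonzero_multiplier_def by (auto elim!: branch_cases)
  then show ?thesis by (simp add: branch_mult_def)
qed

text \<open>The strict inequalities at \<open>z\<close> persist nearby by continuity. The remaining
  ones are imposed by the branch, and where it imposes \<open>H = 0\<close> the product constraint
  holds whatever the sign of \<open>G\<close>.\<close>

lemma branch_locally_feasible:
  fixes P :: "('n::finite) mpvc"
  assumes "z \<in> feasible_set P" "mpvc_cont_differentiable_at P z"
  shows "\<forall>\<^sub>F x in nhds z. (\<forall>j\<in>branch P z. constr_fun P j x \<le> 0 \<and>
    (j \<in> branch_eq P z \<longrightarrow> constr_fun P j x = 0)) \<longrightarrow> x \<in> feasible_set P"
proof -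
  have "\<forall>\<^sub>F x in nhds z. \<forall>i\<in>{i\<in>{1..num_g P}. con_g P i z < 0}. con_g P i x < 0"
    using assms(2) unfolding mpvc_cont_differentiable_at_def
    by (intro eventually_ball_finite) (auto intro!: order_tendstoD(2) cont_differentiable_at_tendsto)
  moreover have "\<forall>\<^sub>F x in nhds z. \<forall>i\<in>{i\<in>{1..num_GH P}. con_G P i z < 0}. con_G P i x < 0"
    using assms(2) unfolding mpvc_cont_differentiable_at_def
    by (intro eventually_ball_finite) (auto intro!: order_tendstoD(2) cont_differentiable_at_tendsto)
  moreover have "\<forall>\<^sub>F x in nhds z. \<forall>i\<in>{i\<in>{1..num_GH P}. 0 < con_H P i z}. 0 < con_H P i x"
    using assms(2) unfolding mpvc_cont_differentiable_at_def
    by (intro eventually_ball_finite) (auto intro!: order_tendstoD(1) cont_differentiable_at_tendsto)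
  ultimately show ?thesis
  proof (eventually_elim, intro impI)
    fix x
    assume near: "\<forall>i\<in>{i\<in>{1..num_g P}. con_g P i z < 0}. con_g P i x < 0"
      "\<forall>i\<in>{i\<in>{1..num_GH P}. con_G P i z < 0}. con_G P i x < 0"
      "\<forall>i\<in>{i\<in>{1..num_GH P}. 0 < con_H P i z}. 0 < con_H P i x"
      and "\<forall>j\<in>branch P z. constr_fun P j x \<le> 0 \<and>
        (j \<in> branch_eq P z \<longrightarrow> constr_fun P j x = 0)"
    then have br: "constr_fun P j x \<le> 0" "j \<in> branch_eq P z \<Longrightarrow> constr_fun P j x = 0"
      if "j \<in> branch P z" for j using that by auto
    have "con_g P i x \<le> 0" if "i \<in> {1..num_g P}" for i
    proof (cases "con_g P i z = 0")
      case True
      then show ?thesis using br(1)[of "Cg i"] that by (simp add: I_g_def)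
    next
      case False
      then have "con_g P i z < 0" using assms(1) that by (force simp: feasible_set_def)
      then show ?thesis using near(1) that by (auto intro: less_imp_le)
    qed
    moreover have "con_h P i x = 0" if "i \<in> {1..num_h P}" for i
      using br(2)[of "Ch i"] that by simp
    moreover have "0 \<le> con_H P i x \<and> con_G P i x * con_H P i x \<le> 0" if i: "i \<in> {1..num_GH P}" for i
    proof -
      have fz: "0 \<le> con_H P i z" "con_G P i z * con_H P i z \<le> 0"
        using assms(1) i by (auto simp: feasible_set_def)
      \<comment> \<open>Feasibility of \<open>z\<close> excludes that \<open>H\<close> and
        \<open>G\<close> are both positive. The first case joins the biactive indices with those in
        \<open>I_zero_plus\<close>, as the branch imposes \<open>H = 0\<close> on both.\<close>
      consider "con_H P i z = 0" "0 \<le> con_G P i z" | "con_H P i z = 0" "con_G P i z < 0"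
        | "0 < con_H P i z" "con_G P i z = 0" | "0 < con_H P i z" "con_G P i z < 0"
        using fz by (smt (verit) mult_pos_pos)
      then show ?thesis
      proof cases
        case 1
        then have "i \<in> I_zero_zero P z \<or> i \<in> I_zero_plus P z"
          using i by (auto simp: I_zero_zero_def I_zero_plus_def)
        then have "con_H P i x = 0" using br(2)[of "CH i"] by auto
        then show ?thesis by simp
      next
        case 2
        then have "0 \<le> con_H P i x" "con_G P i x < 0"
          using br(1)[of "CH i"] near(2) i by (auto simp: I_zero_minus_def)
        then show ?thesis by (simp add: mult_nonpos_nonneg)
      next
        case 3
        then have "0 < con_H P i x" "con_G P i x \<le> 0"
          using br(1)[of "CG i"] near(3) i by (auto simp: I_plus_zero_def)
        then show ?thesis by (simp add: mult_nonpos_nonneg)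
      next
        case 4
        then have "0 < con_H P i x" "con_G P i x < 0"
          using near(2,3) i by auto
        then show ?thesis by (simp add: mult_nonpos_nonneg)
      qed
    qed
    ultimately show "x \<in> feasible_set P" by (simp add: feasible_set_def)
  qed
qed

lemma constr_fun_zero:
  assumes "z \<in> feasible_set P" "j \<in> branch P z"
  shows "constr_fun P j z = 0"
  using assms by (cases j) (auto simp: feasible_set_def index_set_defs)

lemma constr_cont_differentiable:
  fixes P :: "('n::finite) mpvc"
  assumes "mpvc_cont_differentiable_at P z" "j \<in> branch P z"
  shows "\<forall>\<^sub>F x in nhds z. GDERIV (constr_fun P j) x :> constr_grad P j x"
    and "isCont (constr_grad P j) z"
proof -
  have *: "(\<forall>\<^sub>F x in nhds z. GDERIV \<phi> x :> gradient \<phi> x) \<and> isCont (gradient \<phi>) z"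
    if "cont_differentiable_at \<phi> z" for \<phi> :: "real ^ 'n \<Rightarrow> real"
    using that unfolding cont_differentiable_at_def
    by (auto elim: eventually_mono intro: GDERIV_gradient)
  have neg: "\<forall>\<^sub>F x in nhds z. GDERIV (\<lambda>x. - \<phi> x) x :> - gradient \<phi> x"
    if "cont_differentiable_at \<phi> z" for \<phi> :: "real ^ 'n \<Rightarrow> real"
    by (rule eventually_mono[OF conjunct1[OF *[OF that]] GDERIV_minus])
  have "(\<forall>\<^sub>F x in nhds z. GDERIV (constr_fun P j) x :> constr_grad P j x) \<and>
      isCont (constr_grad P j) z"
    using assms(2)
  proof (cases rule: branch_cases)
    case (4 i)
    then have "cont_differentiable_at (con_H P i) z"
      using assms(1) by (simp add: mpvc_cont_differentiable_at_def)
    then show ?thesis using * neg 4 by simp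
  qed (use assms(1) * in \<open>simp_all add: mpvc_cont_differentiable_at_def\<close>)
  then show "\<forall>\<^sub>F x in nhds z. GDERIV (constr_fun P j) x :> constr_grad P j x"
    and "isCont (constr_grad P j) z" by blast+
qed

section \<open>M-stationarity from the KKT multipliers of the branch\<close>

theorem theorem3p5:
  fixes P :: "('n::finite) mpvc" and z :: "real ^ 'n"
  assumes "local_optimal_solution P z"
    and "mpvc_cont_differentiable_at P z"
    and "MPVC_GMFCQ P z \<or> MPVC_linear_CQ P"
  shows "M_stationary P z"
proof -
  have feas: "z \<in> feasible_set P"
    using assms(1) by (simp add: local_optimal_solution_def)
  have obj: "cont_differentiable_at (obj P) z"
    using assms(2) by (simp add: mpvc_cont_differentiable_at_def)
  have "\<forall>\<^sub>F x in nhds z. x \<in> feasible_set P \<longrightarrow> obj P z \<le> obj P x"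
    using assms(1) unfolding local_optimal_solution_def eventually_nhds_metric by blast
  moreover have "\<forall>\<^sub>F x in nhds z. GDERIV (obj P) x :> gradient (obj P) x"
    using obj unfolding cont_differentiable_at_def
    by (auto elim: eventually_mono intro: GDERIV_gradient)
  moreover have "\<forall>\<^sub>F x in nhds z. \<forall>j\<in>branch P z. GDERIV (constr_fun P j) x :> constr_grad P j x"
    by (rule eventually_ball_finite[OF finite_branch])
      (use constr_cont_differentiable(1)[OF assms(2)] in blast)
  moreover note branch_locally_feasible[OF feas assms(2)]
  \<comment> \<open>Points of the branch near \<open>z\<close> are feasible, so \<open>z\<close> is
    also a local minimizer on the branch. All local properties are collected to obtain one common
    radius.\<close>
  ultimately have "\<forall>\<^sub>F x in nhds z.
      ((\<forall>j\<in>branch P z. constr_fun P j x \<le> 0 \<and> (j \<in> branch_eq P z \<longrightarrow> constr_fun P j x = 0)) \<longrightarrow>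
        obj P z \<le> obj P x) \<and>
      GDERIV (obj P) x :> gradient (obj P) x \<and>
      (\<forall>j\<in>branch P z. GDERIV (constr_fun P j) x :> constr_grad P j x)"
    by eventually_elim blast
  then obtain r where "0 < r" and r: "\<And>x. x \<in> cball z r \<Longrightarrow>
      ((\<forall>j\<in>branch P z. constr_fun P j x \<le> 0 \<and> (j \<in> branch_eq P z \<longrightarrow> constr_fun P j x = 0)) \<longrightarrow>
        obj P z \<le> obj P x) \<and>
      GDERIV (obj P) x :> gradient (obj P) x \<and>
      (\<forall>j\<in>branch P z. GDERIV (constr_fun P j) x :> constr_grad P j x)"
    unfolding eventually_nhds_metric_le by (metis dist_commute mem_cball)
  have CQ: "(\<forall>mu. (\<forall>j\<in>branch P z - branch_eq P z. 0 \<le> mu j) \<longrightarrow>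
        (\<Sum>j\<in>branch P z. mu j *\<^sub>R constr_grad P j z) = 0 \<longrightarrow> (\<forall>j\<in>branch P z. mu j = 0)) \<or>
      (\<forall>j\<in>branch P z. \<forall>x. constr_grad P j x = constr_grad P j z)"
    using assms(3)
  proof
    assume "MPVC_GMFCQ P z"
    then show ?thesis using MPVC_GMFCQ_branch by blast
  next
    assume "MPVC_linear_CQ P"
    then have "constr_grad P j x = constr_grad P j z" if "j \<in> branch P z" for j x
      using that unfolding MPVC_linear_CQ_def
      by (auto elim!: branch_cases intro!: gradient_affine_const)
    then show ?thesis by blast
  qed
  obtain mu where mu: "\<forall>j\<in>branch P z - branch_eq P z. 0 \<le> mu j"
    "gradient (obj P) z + (\<Sum>j\<in>branch P z. mu j *\<^sub>R constr_grad P j z) = 0"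
  proof (rule KKT_conditions[OF finite_branch \<open>0 < r\<close> _ _ _ _ _ _ CQ])
    show "GDERIV (obj P) x :> gradient (obj P) x" if "x \<in> cball z r" for x
      using r[OF that] by (elim conjE)
    show "GDERIV (constr_fun P j) x :> constr_grad P j x" if "j \<in> branch P z" "x \<in> cball z r" for j x
      using r[OF that(2)] that(1) by (elim conjE bspec)
    show "isCont (gradient (obj P)) z"
      using obj by (simp add: cont_differentiable_at_def)
    show "isCont (constr_grad P j) z" if "j \<in> branch P z" for j
      by (rule constr_cont_differentiable(2)[OF assms(2) that])
    show "constr_fun P j z = 0" if "j \<in> branch P z" for j
      by (rule constr_fun_zero[OF feas that])
    show "obj P z \<le> obj P x" if "x \<in> cball z r"
      "\<forall>j\<in>branch P z. constr_fun P j x \<le> 0 \<and> (j \<in> branch_eq P z \<longrightarrow> constr_fun P j x = 0)" for x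
      using r[OF that(1)] that(2) by (elim conjE mp)
  qed
  \<comment> \<open>The witnesses are the four parts of \<open>branch_mult P z mu\<close>.\<close>
  then show ?thesis
    using feas branch_multiplier_signs[OF mu(1)] unfolding M_stationary_def branch_multiplier_sum
    by blast
qed

end
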